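(* Let $\Gamma\in\mathbb{R}$ be a cutoff parameter and let $\Delta_0\ge 1$ be an integer. Then the $\ell_2$-descent update policy $\phi$ with cutoff $\Gamma$ is $\ell_2$-contractive.
   Context: $U$ is a set of items. A weighted histogram is a map $H:U\to\mathbb{R}$. Sets $W$ range over subsets of $U$ of size at most $\Delta_0$. The $\ell_2$-descent update policy maps a histogram $H_0$ and a set $W$ to the histogram $H_1=\phi(H_0,W)$ defined by $H_1[u]=H_0[u]$ for $u\notin W$ and $$H_1|_W=H_0|_W+\frac{G}{\max\{\|G\|_{\ell_2},1\}},\qquad G=(\Gamma,\Gamma,\dots,\Gamma)-H_0|_W\in\mathbb{R}^W.$$ $\phi$ is $\ell_2$-contractive if there exists a set $\mathcal{I}\subseteq\{(H_1,H_2):\|H_1-H_2\|_{\ell_2}\le 1\}$ of pairs of weighted histograms such that: (1) $(H_1,H_2)\in\mathcal{I}$ implies $(\phi(H_1,W),\phi(H_2,W))\in\mathcal{I}$ for all $W$; (2) $(\phi(H,W),H)\in\mathcal{I}$ for all weighted histograms $H$ and all $W$. *)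

theory Defs
  imports "HOL-Analysis.Analysis"
begin

text \<open>
  Histograms on the item set \<open>U\<close> are extensional functions, so that two of them are equal as soon
  as they agree on \<open>U\<close>.
\<close>

definition weighted_histograms :: "'u set \<Rightarrow> ('u \<Rightarrow> real) set" where
  "weighted_histograms U = (U \<rightarrow>\<^sub>E UNIV)"

definition item_sets :: "'u set \<Rightarrow> nat \<Rightarrow> 'u set set" where
  "item_sets U \<Delta>\<^sub>0 = {W. W \<subseteq> U \<and> finite W \<and> card W \<le> \<Delta>\<^sub>0}"

text \<open>
  The set \<open>U\<close> may be infinite. The value of \<open>l2_norm A f\<close> is meaningful only if \<open>f\<close> is
  square-summable on \<open>A\<close> (otherwise the library's infinite sum is \<open>0\<close>), so a bound on the norm
  over \<open>U\<close> has to be paired with square-summability.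
\<close>

definition square_summable_on :: "('u \<Rightarrow> real) \<Rightarrow> 'u set \<Rightarrow> bool" where
  "square_summable_on f A \<longleftrightarrow> (\<lambda>u. (f u)\<^sup>2) summable_on A"

definition l2_norm :: "'u set \<Rightarrow> ('u \<Rightarrow> real) \<Rightarrow> real" where
  "l2_norm A f = sqrt (\<Sum>\<^sub>\<infinity>u\<in>A. (f u)\<^sup>2)"

lemma l2_norm_finite: "finite A \<Longrightarrow> l2_norm A f = L2_set f A"
  by (simp add: l2_norm_def L2_set_def)

definition l2_close_pairs :: "'u set \<Rightarrow> (('u \<Rightarrow> real) \<times> ('u \<Rightarrow> real)) set" where
  "l2_close_pairs U =
     {(H1, H2). H1 \<in> weighted_histograms U \<and> H2 \<in> weighted_histograms U \<and>
        square_summable_on (\<lambda>u. H1 u - H2 u) U \<and> l2_norm U (\<lambda>u. H1 u - H2 u) \<le> 1}"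

definition l2_descent :: "real \<Rightarrow> ('u \<Rightarrow> real) \<Rightarrow> 'u set \<Rightarrow> ('u \<Rightarrow> real)" where
  "l2_descent \<Gamma> H W =
     (let G = (\<lambda>u. \<Gamma> - H u)
      in (\<lambda>u. if u \<in> W then H u + G u / max (l2_norm W G) 1 else H u))"

definition l2_contractive ::
    "'u set \<Rightarrow> nat \<Rightarrow> (('u \<Rightarrow> real) \<Rightarrow> 'u set \<Rightarrow> ('u \<Rightarrow> real)) \<Rightarrow> bool" where
  "l2_contractive U \<Delta>\<^sub>0 \<phi> \<longleftrightarrow>
     (\<exists>I \<subseteq> l2_close_pairs U.
        (\<forall>H1 H2. (H1, H2) \<in> I \<longrightarrow> (\<forall>W \<in> item_sets U \<Delta>\<^sub>0. (\<phi> H1 W, \<phi> H2 W) \<in> I)) \<and>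
        (\<forall>H \<in> weighted_histograms U. \<forall>W \<in> item_sets U \<Delta>\<^sub>0. (\<phi> H W, H) \<in> I))"

end

theory Submission
  imports Defs
begin

text \<open>
  The set of all pairs at distance at most 1 already works. In terms of the gap \<open>G = \<Gamma> - H\<close> on
  \<open>W\<close>, the update is \<open>G \<mapsto> G - P G\<close>, where \<open>P\<close> is the projection onto the unit ball. The map
  \<open>G \<mapsto> G - P G\<close> is nonexpansive: by Cauchy-Schwarz this reduces to norms, on which it acts as the
  1-Lipschitz map \<open>r \<mapsto> max (r - 1) 0\<close>. It also moves every point by at most 1.
\<close>

text \<open>Since \<open>U\<close> may be infinite while an update touches only the finite set
  \<open>W\<close>, this reduces both square-summability over \<open>U\<close> and the bound on the
  sum to finite sums over \<open>W\<close>.\<close>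

lemma has_sum_modify_finite:
  fixes f g :: "'u \<Rightarrow> real"
  assumes "(g has_sum s) U" "finite W" "W \<subseteq> U" "\<And>u. u \<in> U - W \<Longrightarrow> f u = g u"
  shows "(f has_sum (s + (sum f W - sum g W))) U"
proof -
  have "((\<lambda>u. f u - g u) has_sum (\<Sum>u\<in>W. f u - g u)) W"
    using assms(2) by (rule has_sum_finite)
  then have "((\<lambda>u. f u - g u) has_sum (sum f W - sum g W)) U"
    using assms(3,4) by (subst has_sum_cong_neutral[where T = W and g = "\<lambda>u. f u - g u"])
      (auto simp: sum_subtractf)
  from has_sum_add[OF assms(1) this] show ?thesis by simp
qed

text \<open>Read \<open>p\<close>, \<open>q\<close> as the norms of two vectors and \<open>c\<close>
  as their inner product. Right side minus left side is affine in \<open>c\<close> with slope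
  \<open>- 2 * (1 - (1 - s) * (1 - t))\<close>, which is at most 0, so the worst case is
  \<open>c = p * q\<close>. There both sides are perfect squares, compared by the last
  hypothesis.\<close>

lemma nonexpansive_scaling_square:
  fixes a b c s t p q :: real
  assumes "0 \<le> s" "s \<le> 1" "0 \<le> t" "t \<le> 1" "c \<le> p * q"
    and "\<bar>(1 - s) * p - (1 - t) * q\<bar> \<le> \<bar>p - q\<bar>"
  shows "(1 - s)\<^sup>2 * p\<^sup>2 + (1 - t)\<^sup>2 * q\<^sup>2 - 2 * ((1 - s) * (1 - t)) * c \<le> p\<^sup>2 + q\<^sup>2 - 2 * c"
proof -
  have "(1 - s) * (1 - t) \<le> 1" using assms by (intro mult_le_one) auto
  then have "(1 - (1 - s) * (1 - t)) * c \<le> (1 - (1 - s) * (1 - t)) * (p * q)"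
    using assms(5) by (intro mult_left_mono) auto
  moreover have "((1 - s) * p - (1 - t) * q)\<^sup>2 \<le> (p - q)\<^sup>2"
    using assms(6) by (simp only: abs_le_square_iff)
  ultimately show ?thesis by (simp add: power2_eq_square algebra_simps)
qed

text \<open>For \<open>r\<close> the norm of \<open>G\<close>, this is the norm of
  \<open>G - P G\<close>.\<close>

lemma minus_div_max_1: "(1 - 1 / max r 1) * r = max (r - 1) (0::real)"
  by (auto simp: max_def field_simps)

lemma sum_square_diff_scaled:
  fixes a b :: "'u \<Rightarrow> real"
  shows "(\<Sum>u\<in>W. (x * a u - y * b u)\<^sup>2) =
    x\<^sup>2 * (L2_set a W)\<^sup>2 + y\<^sup>2 * (L2_set b W)\<^sup>2 - 2 * (x * y) * (\<Sum>u\<in>W. a u * b u)"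
  by (simp add: L2_set_def sum_nonneg power2_diff power_mult_distrib sum.distrib sum_subtractf
      sum_distrib_left mult_ac)

lemma descent_step_nonexpansive:
  fixes a b :: "'u \<Rightarrow> real"
  shows "(\<Sum>u\<in>W. ((1 - 1 / max (L2_set a W) 1) * a u - (1 - 1 / max (L2_set b W) 1) * b u)\<^sup>2)
    \<le> (\<Sum>u\<in>W. (a u - b u)\<^sup>2)"
proof -
  have "(\<Sum>u\<in>W. a u * b u) \<le> (\<Sum>u\<in>W. \<bar>a u\<bar> * \<bar>b u\<bar>)"
    by (intro sum_mono) (metis abs_ge_self abs_mult)
  also have "\<dots> \<le> L2_set a W * L2_set b W" by (rule L2_set_mult_ineq)
  finally show ?thesis
    unfolding sum_square_diff_scaled
      sum_square_diff_scaled[where x = 1 and y = 1, simplified]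
    \<comment> \<open>The scalings are \<open>s = 1 / max p 1\<close> and
      \<open>t = 1 / max q 1\<close> for the two norms \<open>p\<close> and \<open>q\<close>; the
      condition on absolute values is that \<open>max (r - 1) 0\<close> is 1-Lipschitz in
      \<open>r\<close>.\<close>
    by (intro nonexpansive_scaling_square) (auto simp: minus_div_max_1)
qed

lemma descent_step_le_1:
  fixes a :: "'u \<Rightarrow> real"
  shows "(\<Sum>u\<in>W. (a u / max (L2_set a W) 1)\<^sup>2) \<le> 1"
proof -
  have "(\<Sum>u\<in>W. (a u / max (L2_set a W) 1)\<^sup>2) = (L2_set a W / max (L2_set a W) 1)\<^sup>2"
    by (simp add: power_divide L2_set_def sum_nonneg sum_divide_distrib)
  also have "\<dots> \<le> 1"
    by (intro power_le_one) (auto simp: field_simps)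
  finally show ?thesis .
qed

text \<open>One \<open>has_sum\<close> statement carries both summability and the value; the root
  disappears because the bound is 1.\<close>

lemma l2_close_pairs_iff:
  "(H1, H2) \<in> l2_close_pairs U \<longleftrightarrow> H1 \<in> weighted_histograms U \<and> H2 \<in> weighted_histograms U \<and>
    (\<exists>s\<le>1. ((\<lambda>u. (H1 u - H2 u)\<^sup>2) has_sum s) U)"
  unfolding l2_close_pairs_def square_summable_on_def l2_norm_def
  by (auto simp: summable_iff_has_sum_infsum dest: infsumI)

lemma l2_descent_in_weighted_histograms:
  "H \<in> weighted_histograms U \<Longrightarrow> W \<subseteq> U \<Longrightarrow> l2_descent \<Gamma> H W \<in> weighted_histograms U"
  by (auto simp: weighted_histograms_def l2_descent_def PiE_iff extensional_def)

lemma l2_descent_outside: "u \<notin> W \<Longrightarrow> l2_descent \<Gamma> H W u = H u"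
  by (simp add: l2_descent_def)

lemma l2_descent_inside:
  assumes "finite W" "u \<in> W"
  shows "l2_descent \<Gamma> H W u = H u + (\<Gamma> - H u) / max (L2_set (\<lambda>u. \<Gamma> - H u) W) 1"
  using assms by (simp add: l2_descent_def l2_norm_finite)

lemma l2_descent_close_pairs:
  assumes "(H1, H2) \<in> l2_close_pairs U" "finite W" "W \<subseteq> U"
  shows "(l2_descent \<Gamma> H1 W, l2_descent \<Gamma> H2 W) \<in> l2_close_pairs U"
proof -
  let ?d = "\<lambda>u. (l2_descent \<Gamma> H1 W u - l2_descent \<Gamma> H2 W u)\<^sup>2"
  let ?a = "\<lambda>u. \<Gamma> - H1 u" and ?b = "\<lambda>u. \<Gamma> - H2 u"
  obtain s where s: "s \<le> 1" "((\<lambda>u. (H1 u - H2 u)\<^sup>2) has_sum s) U"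
    using assms(1) by (auto simp: l2_close_pairs_iff)
  have "sum ?d W = (\<Sum>u\<in>W. ((1 - 1 / max (L2_set ?a W) 1) * ?a u
      - (1 - 1 / max (L2_set ?b W) 1) * ?b u)\<^sup>2)"
  proof (rule sum.cong)
    fix u assume "u \<in> W"
    \<comment> \<open>On \<open>W\<close> the new histogram is \<Gamma> minus the new gap, so
      \<Gamma> cancels and only a sign remains, which squaring removes.\<close>
    then have "l2_descent \<Gamma> H1 W u - l2_descent \<Gamma> H2 W u =
      - ((1 - 1 / max (L2_set ?a W) 1) * ?a u - (1 - 1 / max (L2_set ?b W) 1) * ?b u)"
      using assms(2) by (simp add: l2_descent_inside left_diff_distrib)
    then show "?d u = ((1 - 1 / max (L2_set ?a W) 1) * ?a u
      - (1 - 1 / max (L2_set ?b W) 1) * ?b u)\<^sup>2"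
      by (simp only: power2_minus)
  qed simp
  also have "\<dots> \<le> (\<Sum>u\<in>W. (?a u - ?b u)\<^sup>2)" by (rule descent_step_nonexpansive)
  also have "\<dots> = (\<Sum>u\<in>W. (H1 u - H2 u)\<^sup>2)" by (simp add: power2_commute)
  finally have "s + (sum ?d W - (\<Sum>u\<in>W. (H1 u - H2 u)\<^sup>2)) \<le> 1" using s(1) by simp
  moreover have "(?d has_sum (s + (sum ?d W - (\<Sum>u\<in>W. (H1 u - H2 u)\<^sup>2)))) U"
    using s(2) assms(2,3) by (rule has_sum_modify_finite) (simp add: l2_descent_outside)
  ultimately show ?thesis
    using assms l2_descent_in_weighted_histograms by (auto simp: l2_close_pairs_iff)
qed

lemma l2_descent_close_to_self:
  assumes "H \<in> weighted_histograms U" "finite W" "W \<subseteq> U"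
  shows "(l2_descent \<Gamma> H W, H) \<in> l2_close_pairs U"
proof -
  let ?d = "\<lambda>u. (l2_descent \<Gamma> H W u - H u)\<^sup>2"
  \<comment> \<open>The difference vanishes off \<open>W\<close>, so it is a modification of the
    zero function on \<open>W\<close>.\<close>
  have "((\<lambda>u. 0::real) has_sum 0) U" by (rule has_sum_0) simp
  from has_sum_modify_finite[OF this assms(2,3), where f = ?d]
  have "(?d has_sum sum ?d W) U" by (simp add: l2_descent_outside)
  moreover have "sum ?d W \<le> 1"
    using descent_step_le_1[of "\<lambda>u. \<Gamma> - H u" W] assms(2)
    by (simp add: l2_descent_inside cong: sum.cong)
  ultimately show ?thesis
    using assms l2_descent_in_weighted_histograms by (auto simp: l2_close_pairs_iff)
qed

theorem lemma5p2:
  fixes U :: "'u set" and \<Gamma> :: real and \<Delta>\<^sub>0 :: nat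
  assumes "\<Delta>\<^sub>0 \<ge> 1"
  shows "l2_contractive U \<Delta>\<^sub>0 (l2_descent \<Gamma>)"
  unfolding l2_contractive_def item_sets_def
  by (rule exI[of _ "l2_close_pairs U"])
    (auto intro: l2_descent_close_pairs l2_descent_close_to_self)

end
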